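(* Let $H$ be a complex Hilbert space, let $T$ be an injective bounded linear operator on $H$, and let $\lambda,\mu\in\mathbb{C}$. Suppose that $I+\mu T$ is invertible. Then \[ \|(I+\lambda T)(I+\mu T)^{-1}\|\le 1 \quad\iff\quad 2h_{W(T^{-1})}(\lambda-\mu)\le|\mu|^2-|\lambda|^2 . \]
   Context: The inner product is linear in its first argument. $I$ is the identity operator on $H$, and $\|\cdot\|$ is the operator norm. For an injective bounded operator $T$ on $H$, $T^{-1}$ denotes the (possibly unbounded) operator with domain $D(T^{-1})=T(H)$ inverse to $T$. For a (possibly unbounded) operator $A$ with domain $D(A)\subset H$, the numerical range of $A$ is $W(A):=\{\langle Ax,x\rangle : x\in D(A),\ \|x\|=1\}$, which is always a convex subset of $\mathbb{C}$. For a non-empty convex subset $\Omega$ of $\mathbb{C}$, its support function $h_\Omega:\mathbb{C}\to(-\infty,\infty]$ is defined by $h_\Omega(z):=\sup\{\operatorname{Re}(z\overline{w}) : w\in\Omega\}$. *)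

theory Defs
  imports "HOL-Analysis.Analysis"
begin

class complex_vector = real_vector +
  fixes scaleC :: "complex \<Rightarrow> 'a \<Rightarrow> 'a"  (infixr "*\<^sub>C" 75)
  assumes scaleC_add_right: "a *\<^sub>C (x + y) = a *\<^sub>C x + a *\<^sub>C y"
    and scaleC_add_left: "(a + b) *\<^sub>C x = a *\<^sub>C x + b *\<^sub>C x"
    and scaleC_scaleC: "a *\<^sub>C (b *\<^sub>C x) = (a * b) *\<^sub>C x"
    and scaleR_scaleC: "r *\<^sub>R x = complex_of_real r *\<^sub>C x"

text \<open>The inner product is linear in its first and conjugate-linear in its second argument.\<close>

class complex_inner = complex_vector + real_normed_vector +
  fixes cinner :: "'a \<Rightarrow> 'a \<Rightarrow> complex"
  assumes cinner_commute: "cinner x y = cnj (cinner y x)"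
    and cinner_add_left: "cinner (x + y) z = cinner x z + cinner y z"
    and cinner_scaleC_left: "cinner (a *\<^sub>C x) y = a * cinner x y"
    and cinner_ge_zero: "0 \<le> Re (cinner x x)"
    and cinner_eq_zero_iff: "cinner x x = 0 \<longleftrightarrow> x = 0"
    and norm_eq_sqrt_cinner: "norm x = sqrt (Re (cinner x x))"

class complex_hilbert_space = complex_inner + complete_space

instantiation complex :: complex_hilbert_space
begin

definition scaleC_complex_def: "a *\<^sub>C (x :: complex) = a * x"

definition cinner_complex_def: "cinner x (y :: complex) = x * cnj y"

instance
  by standard
    (auto simp: scaleC_complex_def cinner_complex_def algebra_simps scaleR_conv_of_real
      cmod_def power2_eq_square complex_eq_iff)

end

locale bounded_clinear = bounded_linear T
  for T :: "'a::complex_inner \<Rightarrow> 'b::complex_inner" +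
  assumes scaleC: "T (c *\<^sub>C x) = c *\<^sub>C T x"

definition boundedly_invertible :: "('a::complex_inner \<Rightarrow> 'a) \<Rightarrow> bool" where
  "boundedly_invertible A \<longleftrightarrow> (\<exists>B. bounded_clinear B \<and> B \<circ> A = id \<and> A \<circ> B = id)"

text \<open>
  A possibly unbounded operator is given by its domain \<open>D\<close> together with a function \<open>A\<close>,
  of which only the values on \<open>D\<close> matter. In particular the inverse of an injective \<open>T\<close> is
  given by the domain \<open>range T\<close> and the function \<open>inv T\<close>.
\<close>

definition numerical_range :: "'a::complex_inner set \<Rightarrow> ('a \<Rightarrow> 'a) \<Rightarrow> complex set" where
  "numerical_range D A = {cinner (A x) x |x. x \<in> D \<and> norm x = 1}"

text \<open>
  The notion is meant for non-empty convex sets; on the empty set, which arises as the numerical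
  range of the inverse of \<open>T\<close> only on the zero space, the value is \<open>-\<infinity>\<close>.
\<close>

definition support_function :: "complex set \<Rightarrow> complex \<Rightarrow> ereal" where
  "support_function \<Omega> z = (SUP w\<in>\<Omega>. ereal (Re (z * cnj w)))"

end

theory Submission
  imports Defs
begin

text \<open>
  Write \<open>S\<close> for the inverse of \<open>I + \<mu> T\<close>. As \<open>I + \<mu> T\<close> is onto, every vector of \<open>H\<close> has the form
  \<open>x + \<mu> T x\<close>, and \<open>(I + \<lambda> T) S\<close> takes it to \<open>x + \<lambda> T x\<close>. Hence \<open>(I + \<lambda> T) S\<close> is a contraction iff
  \<open>\<parallel>x + \<lambda> T x\<parallel> \<le> \<parallel>x + \<mu> T x\<parallel>\<close> for all \<open>x\<close> (\<open>onorm_comp_inv_le_one_iff\<close>).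

  Squaring and expanding, \<open>\<parallel>x\<parallel>\<^sup>2\<close> cancels, and what remains is the inequality
  \<open>2 Re ((\<lambda> - \<mu>) \<langle>T x, x\<rangle>) \<le> (|\<mu>|\<^sup>2 - |\<lambda>|\<^sup>2) \<parallel>T x\<parallel>\<^sup>2\<close> (\<open>norm_add_scaleC_le_iff\<close>). In terms of
  \<open>y = T x\<close> it concerns the quadratic form \<open>\<langle>y, T\<^sup>-\<^sup>1 y\<rangle>\<close>, the conjugate of \<open>\<langle>T\<^sup>-\<^sup>1 y, y\<rangle>\<close>, on the range
  of \<open>T\<close>. Both sides are homogeneous of degree two in \<open>y\<close>, so it suffices to ask for it when
  \<open>\<parallel>y\<parallel> = 1\<close>, and this is the bound \<open>2 Re ((\<lambda> - \<mu>) cnj w) \<le> |\<mu>|\<^sup>2 - |\<lambda>|\<^sup>2\<close> for all \<open>w\<close> in the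
  numerical range of \<open>T\<^sup>-\<^sup>1\<close> (\<open>numerical_range_inv_bound_iff\<close>). The bound on the support function
  says the same.
\<close>

lemma cinner_add_right: "cinner x (y + z) = cinner x y + cinner x (z::'a::complex_inner)"
  by (metis cinner_add_left cinner_commute complex_cnj_add)

lemma cinner_scaleC_right: "cinner x (a *\<^sub>C y) = cnj a * cinner x (y::'a::complex_inner)"
  by (metis cinner_scaleC_left cinner_commute complex_cnj_mult)

lemma norm_power2_cinner: "(norm (x::'a::complex_inner))\<^sup>2 = Re (cinner x x)"
  by (simp add: norm_eq_sqrt_cinner cinner_ge_zero)

lemma norm_add_scaleC_power2:
  fixes x y :: "'a::complex_inner"
  shows "(norm (x + c *\<^sub>C y))\<^sup>2
    = (norm x)\<^sup>2 + 2 * Re (c * cinner y x) + (cmod c)\<^sup>2 * (norm y)\<^sup>2"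
proof -
  have "Re (cnj c * cinner x y) = Re (c * cinner y x)"
    by (subst cinner_commute) simp
  moreover have "Re (c * (cnj c * cinner y y)) = (cmod c)\<^sup>2 * Re (cinner y y)"
  proof -
    have *: "c * (cnj c * cinner y y) = of_real ((cmod c)\<^sup>2) * cinner y y"
      by (simp only: complex_norm_square mult.assoc)
    show ?thesis
      unfolding * by (simp del: of_real_power)
  qed
  ultimately show ?thesis
    by (simp add: norm_power2_cinner[where 'a = 'a] cinner_add_left cinner_add_right
        cinner_scaleC_left cinner_scaleC_right algebra_simps del: times_complex.simps)
qed

lemma norm_add_scaleC_le_iff:
  fixes x y :: "'a::complex_inner"
  shows "norm (x + a *\<^sub>C y) \<le> norm (x + b *\<^sub>C y)
    \<longleftrightarrow> 2 * Re ((a - b) * cinner y x) \<le> ((cmod b)\<^sup>2 - (cmod a)\<^sup>2) * (norm y)\<^sup>2"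
proof -
  have "norm (x + a *\<^sub>C y) \<le> norm (x + b *\<^sub>C y)
      \<longleftrightarrow> (norm (x + a *\<^sub>C y))\<^sup>2 \<le> (norm (x + b *\<^sub>C y))\<^sup>2"
    by (simp add: power2_le_iff_abs_le)
  then show ?thesis
    unfolding norm_add_scaleC_power2 by (auto simp: algebra_simps)
qed

lemma bounded_linear_scaleC: "bounded_linear (\<lambda>x::'a::complex_inner. c *\<^sub>C x)"
proof (rule bounded_linear_intro[where K = "cmod c"])
  fix x y :: 'a and r :: real
  show "c *\<^sub>C (x + y) = c *\<^sub>C x + c *\<^sub>C y"
    by (rule scaleC_add_right)
  show "c *\<^sub>C (r *\<^sub>R x) = r *\<^sub>R (c *\<^sub>C x)"
    by (simp add: scaleR_scaleC scaleC_scaleC mult.commute)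
  \<comment> \<open>The class axioms relate the norm to \<open>scaleR\<close> only; for \<open>scaleC\<close> the expansion of
    \<open>\<parallel>0 + c x\<parallel>\<^sup>2\<close> gives the homogeneity of the norm.\<close>
  have "(norm (c *\<^sub>C x))\<^sup>2 = (norm x * cmod c)\<^sup>2"
    using norm_add_scaleC_power2[of 0 c x] norm_add_scaleC_power2[of 0 0 x]
      cinner_scaleC_left[of 0 x 0] cinner_add_right[of x 0 0]
    by (simp add: power_mult_distrib mult.commute)
  then show "norm (c *\<^sub>C x) \<le> norm x * cmod c"
    by (simp add: power2_eq_iff_nonneg)
qed

lemma onorm_le_one_iff:
  assumes "bounded_linear f"
  shows "onorm f \<le> 1 \<longleftrightarrow> (\<forall>x. norm (f x) \<le> norm x)"
proof
  assume "onorm f \<le> 1"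
  then show "\<forall>x. norm (f x) \<le> norm x"
    using onorm[OF assms] by (meson mult_left_le_one_le norm_ge_zero onorm_pos_le[OF assms]
        order_trans)
next
  assume "\<forall>x. norm (f x) \<le> norm x"
  then show "onorm f \<le> 1"
    by (intro onorm_bound) simp_all
qed

lemma onorm_comp_inv_le_one_iff:
  assumes A: "bounded_linear A" and B: "boundedly_invertible B"
  shows "onorm (A \<circ> inv B) \<le> 1 \<longleftrightarrow> (\<forall>x. norm (A x) \<le> norm (B x))"
proof -
  obtain C where C: "bounded_clinear C" "C \<circ> B = id" "B \<circ> C = id"
    using B unfolding boundedly_invertible_def by blast
  have inv: "inv B = C"
    using C by (intro inv_unique_comp)
  have "bounded_linear (A \<circ> C)"
    using A C(1) unfolding o_def bounded_clinear_def by (blast intro: bounded_linear_compose)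
  then have "onorm (A \<circ> inv B) \<le> 1 \<longleftrightarrow> (\<forall>y. norm (A (C y)) \<le> norm y)"
    by (simp add: inv onorm_le_one_iff)
  also have "\<dots> \<longleftrightarrow> (\<forall>x. norm (A x) \<le> norm (B x))"
    using C(2,3) by (metis comp_apply id_apply)
  finally show ?thesis .
qed

text \<open>
  Doubling is an order isomorphism of the extended reals, so the factor passes through the supremum.
  For empty \<open>\<Omega>\<close> both sides hold, the left one because \<open>2 * -\<infinity> = -\<infinity>\<close>.
\<close>

lemma support_function_bound_iff:
  "2 * support_function \<Omega> z \<le> ereal c \<longleftrightarrow> (\<forall>w\<in>\<Omega>. 2 * Re (z * cnj w) \<le> c)"
proof -
  have *: "2 * s \<le> ereal c \<longleftrightarrow> s \<le> ereal (c / 2)" for s :: ereal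
    by (cases s) (auto simp: numeral_eq_ereal)
  show ?thesis
    unfolding support_function_def * by (simp add: SUP_le_iff field_simps del: times_complex.simps)
qed

text \<open>
  The passage from unit vectors \<open>y = T x\<close> to arbitrary \<open>x\<close>: injectivity of \<open>T\<close> guarantees that
  \<open>T x \<noteq> 0\<close> unless \<open>x = 0\<close>, so that \<open>x\<close> can be rescaled to make \<open>T x\<close> a unit vector.
\<close>

lemma numerical_range_inv_bound_iff:
  fixes T :: "'a::complex_inner \<Rightarrow> 'a"
  assumes "linear T" and "inj T"
  shows "(\<forall>w\<in>numerical_range (range T) (inv T). 2 * Re (z * cnj w) \<le> c)
    \<longleftrightarrow> (\<forall>x. 2 * Re (z * cinner (T x) x) \<le> c * (norm (T x))\<^sup>2)"
proof -
  interpret linear T by fact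
  have "numerical_range (range T) (inv T) = {cnj (cinner (T x) x) |x. norm (T x) = 1}"
    using \<open>inj T\<close>
    by (auto simp: numerical_range_def simp flip: cinner_commute) (metis inv_f_f rangeI)
  then have "(\<forall>w\<in>numerical_range (range T) (inv T). 2 * Re (z * cnj w) \<le> c)
      \<longleftrightarrow> (\<forall>x. norm (T x) = 1 \<longrightarrow> 2 * Re (z * cinner (T x) x) \<le> c)"
    by auto
  also have "\<dots> \<longleftrightarrow> (\<forall>x. 2 * Re (z * cinner (T x) x) \<le> c * (norm (T x))\<^sup>2)"
  proof (intro iffI allI impI)
    fix x
    assume unit: "\<forall>x. norm (T x) = 1 \<longrightarrow> 2 * Re (z * cinner (T x) x) \<le> c"
    show "2 * Re (z * cinner (T x) x) \<le> c * (norm (T x))\<^sup>2"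
    proof (cases "x = 0")
      case True
      then show ?thesis
        using cinner_eq_zero_iff[of x] by (simp add: zero)
    next
      case False
      define r where "r = norm (T x)"
      have "T x \<noteq> 0"
        using False \<open>inj T\<close> zero by (metis injD)
      then have r: "r > 0"
        by (simp add: r_def)
      define u where "u = (1 / r) *\<^sub>R x"
      have u: "x = r *\<^sub>R u" "norm (T u) = 1"
        using r by (simp_all add: u_def scaleR flip: r_def)
      have "cinner (T x) x = r\<^sup>2 * cinner (T u) u"
        unfolding u(1) scaleR
        by (simp add: scaleR_scaleC cinner_scaleC_left cinner_scaleC_right
            power2_eq_square)
      then have "2 * Re (z * cinner (T x) x) = r\<^sup>2 * (2 * Re (z * cinner (T u) u))"
        by (simp add: algebra_simps flip: of_real_power)
      also have "\<dots> \<le> r\<^sup>2 * c"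
        using unit u(2) by (intro mult_left_mono) auto
      finally show ?thesis
        by (simp add: r_def mult.commute)
    qed
  next
    fix x
    assume "\<forall>x. 2 * Re (z * cinner (T x) x) \<le> c * (norm (T x))\<^sup>2" and "norm (T x) = 1"
    then show "2 * Re (z * cinner (T x) x) \<le> c"
      by (metis mult.right_neutral power_one)
  qed
  finally show ?thesis .
qed

theorem theorem1p1:
  fixes T :: "'h::complex_hilbert_space \<Rightarrow> 'h" and lam mu :: complex
  assumes "bounded_clinear T" and "inj T"
    and "boundedly_invertible (\<lambda>x. x + mu *\<^sub>C T x)"
  shows "onorm ((\<lambda>x. x + lam *\<^sub>C T x) \<circ> inv (\<lambda>x. x + mu *\<^sub>C T x)) \<le> 1
    \<longleftrightarrow> 2 * support_function (numerical_range (range T) (inv T)) (lam - mu)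
        \<le> ereal ((cmod mu)\<^sup>2 - (cmod lam)\<^sup>2)"
proof -
  have T: "bounded_linear T"
    using assms(1) by (simp add: bounded_clinear_def)
  have "bounded_linear (\<lambda>x. x + lam *\<^sub>C T x)"
    by (intro bounded_linear_add bounded_linear_ident
        bounded_linear_compose[OF bounded_linear_scaleC T])
  from onorm_comp_inv_le_one_iff[OF this assms(3)] show ?thesis
    by (simp only: norm_add_scaleC_le_iff support_function_bound_iff
        numerical_range_inv_bound_iff[OF bounded_linear.linear[OF T] assms(2)])
qed

end
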